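(* Let $r>6$ and $n$ be integers with $3r+3\le n\le r^2$, and put $a=n-2r+1$ and $b=2r-1$. Suppose $a$ is a power of a prime with $a\equiv 1\pmod 4$ and $2r+5\le a\le \min\{4r-3,\,(r-1)^2\}$. Then the Paley graph $X=P(a)$ satisfies: (i) $\alpha(X)\le r-1$; (ii) $\kappa(X)\ge a-b$; (iii) $\Delta(X)\ge r+2$.
   Context: For a prime power $q\equiv 1\pmod 4$, the Paley graph $P(q)$ is the graph with vertex set the finite field $\mathbb{F}_q$ in which two distinct vertices $x,y$ are adjacent if and only if $x-y$ is a non-zero quadratic residue (non-zero square) in $\mathbb{F}_q$. $\alpha(X)$ is the maximum size of an independent set of $X$ and $\Delta(X)$ is the maximum degree. A graph is $k$-connected if it has at least $k+1$ vertices and removal of any $k-1$ or fewer vertices leaves a connected graph; $\kappa(X)$ is the largest $k$ for which $X$ is $k$-connected. *)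

theory Defs
  imports
    "HOL-Number_Theory.Number_Theory"
    "HOL-Computational_Algebra.Nth_Powers"
    "HOL-Library.Cardinality"
    "Graph_Theory.Graph_Theory"
begin

text \<open>
  A finite simple graph is a \<open>pair_pre_digraph\<close> (in the sense of locale \<open>pair_graph\<close>): each
  edge is represented by the two arcs \<open>(u, v)\<close> and \<open>(v, u)\<close>. The parameters below are only
  meaningful for such graphs with at least one vertex; the sets under \<open>Max\<close> are then finite and
  nonempty.
\<close>

definition independent_set :: "'a pair_pre_digraph \<Rightarrow> 'a set \<Rightarrow> bool" where
  "independent_set X S \<longleftrightarrow> S \<subseteq> pverts X \<and> (\<forall>u\<in>S. \<forall>v\<in>S. (u, v) \<notin> parcs X)"

definition independence_number :: "'a pair_pre_digraph \<Rightarrow> nat" where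
  "independence_number X = Max {card S |S. independent_set X S}"

text \<open>As both arcs of an edge are present, the degree of a vertex is its out-degree.\<close>

definition max_degree :: "'a pair_pre_digraph \<Rightarrow> nat" where
  "max_degree X = Max (out_degree (with_proj X) ` pverts X)"

definition k_connected :: "nat \<Rightarrow> 'a pair_pre_digraph \<Rightarrow> bool" where
  "k_connected k X \<longleftrightarrow>
     k + 1 \<le> card (pverts X) \<and>
     (\<forall>S \<subseteq> pverts X. card S < k \<longrightarrow>
        Digraph_Component.connected (with_proj X \<restriction> (pverts X - S)))"

definition vertex_connectivity :: "'a pair_pre_digraph \<Rightarrow> nat" where
  "vertex_connectivity X = Max {k. k_connected k X}"

text \<open>
  The order of the field is \<open>CARD('f)\<close>. The arc relation is symmetric precisely when \<open>-1\<close> is a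
  square, which is the case if \<open>CARD('f)\<close> is congruent to 1 modulo 4.
\<close>

definition paley_graph :: "'f::{field,finite} pair_pre_digraph" where
  "paley_graph =
     \<lparr>pverts = UNIV, parcs = {(x, y). x \<noteq> y \<and> is_square (x - y)}\<rparr>"

end

theory Submission
  imports Defs "HOL-Library.Z2"
begin

text \<open>
  Write \<open>q\<close> for the odd order of the field and \<open>k = (q - 1) / 2\<close>. There are \<open>k\<close> non-zero squares
  and \<open>k\<close> non-squares, and the product of two non-squares is a square
  (\<open>card_nonzero_squares\<close>, \<open>nonsquare_mult_nonsquare\<close>). All three claims rest on this.

  The Paley graph is \<open>k\<close>-regular, and \<open>k \<ge> r + 2\<close> because \<open>a \<ge> 2 * r + 5\<close>.

  If \<open>S\<close> is independent, all differences of distinct elements of \<open>S\<close> are non-squares. For a fixed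
  non-square \<open>z\<close> the map \<open>(s, t) \<mapsto> s + z * t\<close> is then injective on \<open>S \<times> S\<close>: a coincidence would
  express a non-square \<open>s - s'\<close> as the product of the non-squares \<open>z\<close> and \<open>t' - t\<close>. Hence
  \<open>(card S)\<^sup>2 \<le> q \<le> (r - 1)\<^sup>2\<close>.

  For the connectivity, two distinct vertices have at most \<open>k / 2\<close> common non-neighbours
  (\<open>card_common_nonneighbours_le\<close>). Suppose that fewer than \<open>k\<close> vertices are removed and the
  remaining ones, of which there are at least \<open>k + 2\<close>, split into non-empty parts \<open>A\<close> and \<open>B\<close>
  without edges between them. If \<open>A\<close> is a single vertex, then \<open>B\<close> lies among its \<open>k\<close>
  non-neighbours and \<open>card A + card B \<le> k + 1\<close>; likewise if \<open>B\<close> is a single vertex. Otherwise each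
  part consists of common non-neighbours of two vertices of the other part, so both have at most
  \<open>k / 2\<close> elements and \<open>card A + card B \<le> k\<close>. Either way this is a contradiction, so the graph is
  \<open>k\<close>-connected. Finally \<open>k \<ge> a - b\<close> because \<open>a \<le> 4 * r - 3\<close>.
\<close>

section \<open>Squares in finite fields of odd order\<close>

definition nonzero_squares :: "'f::{field,finite} set" where
  "nonzero_squares = {x. x \<noteq> 0 \<and> is_square x}"

definition nonsquares :: "'f::{field,finite} set" where
  "nonsquares = {x. \<not> is_square x}"

lemma zero_notin_nonzero_squares [simp]: "0 \<notin> nonzero_squares"
  by (simp add: nonzero_squares_def)

lemma nonsquares_conv: "nonsquares = - insert 0 nonzero_squares"
  by (auto simp: nonsquares_def nonzero_squares_def)

lemma nonzero_squares_mult: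
  "x \<in> nonzero_squares \<Longrightarrow> y \<in> nonzero_squares \<Longrightarrow> x * y \<in> nonzero_squares"
  by (auto simp: nonzero_squares_def is_nth_power_mult)

lemma nonzero_squares_inverse: "x \<in> nonzero_squares \<Longrightarrow> inverse x \<in> nonzero_squares"
  by (auto simp: nonzero_squares_def is_nth_power_def simp flip: power_inverse)

lemma nonzero_squares_divide:
  "x \<in> nonzero_squares \<Longrightarrow> y \<in> nonzero_squares \<Longrightarrow> x / y \<in> nonzero_squares"
  by (simp add: divide_inverse nonzero_squares_mult nonzero_squares_inverse)

lemma nonsquare_mult_nonzero_square:
  assumes "x \<in> nonsquares" "y \<in> nonzero_squares"
  shows "x * y \<in> nonsquares"
proof (rule ccontr)
  have nz: "x \<noteq> 0" "y \<noteq> 0" using assms by (auto simp: nonzero_squares_def nonsquares_def)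
  assume "x * y \<notin> nonsquares"
  then have "x * y \<in> nonzero_squares"
    using nz by (simp add: nonsquares_conv)
  then have "x * y * inverse y \<in> nonzero_squares"
    using assms(2) nonzero_squares_mult nonzero_squares_inverse by blast
  then show False
    using assms(1) nz by (simp add: nonsquares_conv mult.assoc)
qed

text \<open>If \<open>1 + 1 = 0\<close>, then \<open>x \<mapsto> x + 1\<close> pairs up the elements of the field.\<close>

lemma one_plus_one_neq_zero:
  assumes "odd CARD('f::{field,finite})"
  shows "(1::'f) + 1 \<noteq> 0"
proof
  assume eq: "(1::'f) + 1 = 0"
  (* A sum of ones in the two-element field records the parity of the number of summands. *)
  have "(\<Sum>x\<in>(UNIV :: 'f set). 1 :: bit) = 0"
    by (rule sum_involution_eq_0[where h = "\<lambda>x. x + 1"])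
       (use eq in \<open>simp_all add: add.assoc del: one_add_one\<close>)
  then have "of_nat CARD('f) = (0 :: bit)" by simp
  moreover have "of_nat CARD('f) = (1 :: bit)" using assms by (auto elim: oddE)
  ultimately show False by simp
qed

text \<open>Squaring is two-to-one on the non-zero elements.\<close>

lemma card_nonzero_squares:
  assumes "odd CARD('f::{field,finite})"
  shows "2 * card (nonzero_squares :: 'f set) + 1 = CARD('f)"
proof -
  let ?roots = "\<lambda>s :: 'f. {x. x\<^sup>2 = s}"
  have card_roots: "card (?roots s) = 2" if s: "s \<in> nonzero_squares" for s
  proof -
    obtain y where y: "s = y\<^sup>2"
      using s by (auto simp: nonzero_squares_def is_nth_power_def)
    have "y \<noteq> 0" using s y by auto
    have "y \<noteq> - y"
    proof
      assume "y = - y"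
      then have "y * (1 + 1) = 0" by (simp add: algebra_simps add_eq_0_iff2)
      then show False using \<open>y \<noteq> 0\<close> one_plus_one_neq_zero[OF assms] by simp
    qed
    moreover have "?roots s = {y, - y}" using y by (auto simp: power2_eq_iff)
    ultimately show ?thesis by simp
  qed
  have inj: "inj_on ?roots nonzero_squares"
    by (rule inj_onI) (auto simp: nonzero_squares_def is_nth_power_def)
  have "2 * card (?roots ` nonzero_squares) = card (\<Union> (?roots ` nonzero_squares))"
    by (rule card_partition) (use card_roots in auto)
  moreover have "\<Union> (?roots ` nonzero_squares) = UNIV - {0}"
    by (auto simp: nonzero_squares_def is_nth_power_def)
  ultimately have "2 * card (nonzero_squares :: 'f set) = CARD('f) - 1"
    using inj by (simp add: card_image)
  then show ?thesis using zero_less_card_finite[where 'a = 'f] by linarith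
qed

lemma card_nonsquares:
  assumes "odd CARD('f::{field,finite})"
  shows "card (nonsquares :: 'f set) = card (nonzero_squares :: 'f set)"
  using card_nonzero_squares[OF assms]
  by (simp add: nonsquares_conv Compl_eq_Diff_UNIV card_Diff_subset)

text \<open>
  Multiplication by a non-square maps the non-zero squares injectively into the non-squares, hence
  onto them, as there are equally many of both.
\<close>

lemma nonsquare_mult_nonsquare:
  assumes "odd CARD('f::{field,finite})" "x \<in> nonsquares" "(y::'f) \<in> nonsquares"
  shows "x * y \<in> nonzero_squares"
proof -
  have nz: "x \<noteq> 0" using assms(2) by (auto simp: nonsquares_def)
  have "(*) x ` nonzero_squares = nonsquares"
  proof (rule card_subset_eq)
    show "(*) x ` nonzero_squares \<subseteq> nonsquares"
      using assms(2) nonsquare_mult_nonzero_square by blast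
    show "card ((*) x ` nonzero_squares) = card (nonsquares :: 'f set)"
      using nz card_nonsquares[OF assms(1)] by (simp add: card_image inj_on_def)
  qed simp
  then obtain s where s: "s \<in> nonzero_squares" "y = x * s"
    using assms(3) by blast
  have "x\<^sup>2 \<in> nonzero_squares" using nz by (auto simp: nonzero_squares_def)
  then have "x\<^sup>2 * s \<in> nonzero_squares" using s(1) nonzero_squares_mult by blast
  then show ?thesis using s(2) by (simp add: power2_eq_square mult.assoc)
qed

lemma nonsquare_divide_nonsquare:
  assumes "odd CARD('f::{field,finite})" "x \<in> nonsquares" "(y::'f) \<in> nonsquares"
  shows "x / y \<in> nonzero_squares"
proof -
  have "inverse y \<in> nonsquares"
    using nonzero_squares_inverse[of "inverse y"] assms(3)
    by (auto simp: nonsquares_conv)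
  then show ?thesis
    using nonsquare_mult_nonsquare assms(1,2) by (metis divide_inverse)
qed

section \<open>Independent sets of the Paley graph\<close>

lemma independent_set_paley_iff:
  "independent_set (paley_graph :: 'f::{field,finite} pair_pre_digraph) S \<longleftrightarrow>
     (\<forall>u\<in>S. \<forall>v\<in>S. u \<noteq> v \<longrightarrow> u - v \<in> nonsquares)"
  by (auto simp: independent_set_def paley_graph_def nonsquares_def)

lemma card_independent_set_paley:
  fixes S :: "'f::{field,finite} set"
  assumes "odd CARD('f)" "2 \<le> CARD('f)" "independent_set paley_graph S"
  shows "(card S)\<^sup>2 \<le> CARD('f)"
proof -
  have "card (nonsquares :: 'f set) > 0"
    using card_nonzero_squares[OF assms(1)] card_nonsquares[OF assms(1)] assms(2) by linarith
  then obtain z :: 'f where z: "z \<in> nonsquares" by (auto simp: card_gt_0_iff)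
  let ?f = "\<lambda>(s, t). s + z * t"
  have "inj_on ?f (S \<times> S)"
  proof (intro inj_onI, clarify)
    fix s t s' t'
    assume mem: "s \<in> S" "t \<in> S" "s' \<in> S" "t' \<in> S" and eq: "s + z * t = s' + z * t'"
    then have diff: "s - s' = z * (t' - t)" by (simp add: algebra_simps)
    have "t = t'"
    proof (rule ccontr)
      assume "t \<noteq> t'"
      then have "t' - t \<in> nonsquares"
        using assms(3) mem by (auto simp: independent_set_paley_iff)
      then have "s - s' \<in> nonzero_squares"
        unfolding diff using nonsquare_mult_nonsquare[OF assms(1) z] by blast
      moreover from this have "s \<noteq> s'" by auto
      then have "s - s' \<in> nonsquares"
        using assms(3) mem by (auto simp: independent_set_paley_iff)
      ultimately show False by (simp add: nonsquares_conv)
    qed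
    then show "s = s' \<and> t = t'" using diff by simp
  qed
  then have "card (S \<times> S) \<le> CARD('f)" by (metis card_inj_on_le finite subset_UNIV)
  then show ?thesis by (simp add: card_cartesian_product power2_eq_square)
qed

lemma independence_number_paley:
  assumes "odd CARD('f::{field,finite})" "2 \<le> CARD('f)"
  shows "(independence_number (paley_graph :: 'f pair_pre_digraph))\<^sup>2 \<le> CARD('f)"
proof -
  let ?C = "{card S |S. independent_set (paley_graph :: 'f pair_pre_digraph) S}"
  have "Max ?C \<in> ?C"
  proof (rule Max_in)
    show "finite ?C" by simp
    have "independent_set paley_graph ({} :: 'f set)" by (simp add: independent_set_def)
    then show "?C \<noteq> {}" by blast
  qed
  then show ?thesis
    unfolding independence_number_def using card_independent_set_paley[OF assms] by auto
qed

section \<open>The degree of the Paley graph\<close>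

lemma out_degree_paley:
  "out_degree (with_proj (paley_graph :: 'f::{field,finite} pair_pre_digraph)) v =
     card (nonzero_squares :: 'f set)"
proof -
  have "out_arcs (with_proj (paley_graph :: 'f pair_pre_digraph)) v = (\<lambda>s. (v, v - s)) ` nonzero_squares"
  proof (intro equalityI subsetI)
    fix e assume "e \<in> out_arcs (with_proj (paley_graph :: 'f pair_pre_digraph)) v"
    then obtain w where w: "e = (v, w)" "v - w \<in> nonzero_squares"
      by (cases e) (simp add: out_arcs_def paley_graph_def nonzero_squares_def)
    then have "e = (v, v - (v - w))" by simp
    then show "e \<in> (\<lambda>s. (v, v - s)) ` nonzero_squares" using w(2) by (rule image_eqI)
  qed (auto simp: out_arcs_def paley_graph_def nonzero_squares_def)
  then show ?thesis by (simp add: out_degree_def card_image inj_on_def)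
qed

lemma max_degree_paley:
  "max_degree (paley_graph :: 'f::{field,finite} pair_pre_digraph) =
     card (nonzero_squares :: 'f set)"
  by (simp add: max_degree_def out_degree_paley) (simp add: paley_graph_def)

section \<open>The connectivity of the Paley graph\<close>

lemma card_diff_in:
  fixes Q :: "'f::{field,finite} set"
  shows "card {z. z - x \<in> Q} = card Q"
proof -
  have "{z. z - x \<in> Q} = (\<lambda>s. s + x) ` Q"
    by (metis (no_types, lifting) add_diff_cancel_right' diff_add_cancel image_iff mem_Collect_eq subsetI subset_antisym)
  then show ?thesis by (simp add: card_image inj_on_def)
qed

text \<open>
  Sort the vertices \<open>z\<close> other than \<open>x\<close> and \<open>y\<close> by the quadratic characters of \<open>z - x\<close> and \<open>z - y\<close>.
  Counting the \<open>z\<close> with \<open>z - x\<close> a non-square, and those with \<open>z - y\<close> a square, shows that the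
  class "both non-squares" exceeds the class "both squares" by at most one. The two classes together
  are the \<open>z\<close> for which \<open>(z - x) / (z - y)\<close> is a non-zero square; since this Moebius transformation
  is injective and omits the value \<open>1\<close>, together they have fewer elements than there are non-zero
  squares.
\<close>

lemma card_common_nonneighbours_le:
  fixes x y :: "'f::{field,finite}"
  assumes odd: "odd CARD('f)" and "x \<noteq> y"
  shows "2 * card {z. z - x \<in> nonsquares \<and> z - y \<in> nonsquares} \<le> card (nonzero_squares :: 'f set)"
proof -
  let ?Q = "nonzero_squares :: 'f set" and ?N = "nonsquares :: 'f set"
  let ?NN = "{z. z - x \<in> ?N \<and> z - y \<in> ?N}"
  let ?QQ = "{z. z - x \<in> ?Q \<and> z - y \<in> ?Q}"
  let ?NQ = "{z. z - x \<in> ?N \<and> z - y \<in> ?Q}"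
  have one: "1 \<in> ?Q" by (simp add: nonzero_squares_def)
  have "card ?NN + card ?NQ = card (?NN \<union> ?NQ)"
    by (rule card_Un_disjoint[symmetric]) (auto simp: nonsquares_conv)
  also have "\<dots> \<le> card {z. z - x \<in> ?N}" by (rule card_mono) auto
  also have "\<dots> = card ?Q" using card_nonsquares[OF odd] by (simp add: card_diff_in)
  finally have NN: "card ?NN + card ?NQ \<le> card ?Q" .
  have "card ?Q = card {z. z - y \<in> ?Q}" by (simp add: card_diff_in)
  (* The vertex x belongs to neither class, as x - x = 0, but x - y may be a square. *)
  also have "\<dots> \<le> card (insert x (?QQ \<union> ?NQ))"
    by (rule card_mono) (auto simp: nonsquares_conv)
  also have "\<dots> \<le> Suc (card (?QQ \<union> ?NQ))" by (rule card_insert_le_m1) auto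
  also have "\<dots> \<le> Suc (card ?QQ + card ?NQ)" using card_Un_le by blast
  finally have QQ: "card ?Q \<le> Suc (card ?QQ + card ?NQ)" .
  have "card (?NN \<union> ?QQ) \<le> card (?Q - {1})"
  proof (rule card_inj_on_le)
    let ?f = "\<lambda>z. (z - x) / (z - y)"
    show "inj_on ?f (?NN \<union> ?QQ)"
    proof (rule inj_onI)
      fix z w assume mem: "z \<in> ?NN \<union> ?QQ" "w \<in> ?NN \<union> ?QQ" and eq: "?f z = ?f w"
      have nz: "z - y \<noteq> 0" "w - y \<noteq> 0" using mem by (auto simp: nonsquares_conv)
      then have "(z - x) * (w - y) = (w - x) * (z - y)"
        using eq by (simp add: frac_eq_eq)
      then have "(x - y) * (z - w) = 0" by (simp add: algebra_simps)
      then show "z = w" using \<open>x \<noteq> y\<close> by simp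
    qed
    show "?f ` (?NN \<union> ?QQ) \<subseteq> ?Q - {1}"
    proof
      fix v assume "v \<in> ?f ` (?NN \<union> ?QQ)"
      then obtain z where z: "z \<in> ?NN \<union> ?QQ" "v = ?f z" by blast
      have "z - y \<noteq> 0" using z(1) by (auto simp: nonsquares_conv)
      then have "v \<noteq> 1" using z(2) \<open>x \<noteq> y\<close> by (simp add: divide_eq_1_iff)
      moreover have "v \<in> ?Q"
        using z nonsquare_divide_nonsquare[OF odd] nonzero_squares_divide by blast
      ultimately show "v \<in> ?Q - {1}" by simp
    qed
  qed simp
  moreover have "card (?NN \<union> ?QQ) = card ?NN + card ?QQ"
    by (rule card_Un_disjoint) (auto simp: nonsquares_conv)
  moreover have "card (?Q - {1}) < card ?Q" using one by (intro card_Diff1_less) auto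
  ultimately show ?thesis using NN QQ by linarith
qed

lemma connected_if_no_empty_cut:
  assumes "verts G \<noteq> {}"
    and cut: "\<And>A B. A \<union> B = verts G \<Longrightarrow> A \<inter> B = {} \<Longrightarrow> A \<noteq> {} \<Longrightarrow> B \<noteq> {} \<Longrightarrow>
      \<exists>x\<in>A. \<exists>y\<in>B. (x, y) \<in> arcs_ends G \<or> (y, x) \<in> arcs_ends G"
  shows "Digraph_Component.connected G"
  unfolding connected_conv
proof (intro conjI ballI)
  fix u v assume u: "u \<in> verts G" and v: "v \<in> verts G"
  let ?R = "rtrancl_on (verts G) ((arcs_ends G)\<^sup>s)"
  define A where "A = {w \<in> verts G. (u, w) \<in> ?R}"
  show "(u, v) \<in> ?R"
  proof (rule ccontr)
    assume "(u, v) \<notin> ?R"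
    then have "\<exists>x\<in>A. \<exists>y\<in>verts G - A. (x, y) \<in> arcs_ends G \<or> (y, x) \<in> arcs_ends G"
      using u v by (intro cut) (auto simp: A_def)
    then obtain x y where xy: "x \<in> A" "y \<in> verts G - A"
      and "(x, y) \<in> arcs_ends G \<or> (y, x) \<in> arcs_ends G" by blast
    then have "(x, y) \<in> (arcs_ends G)\<^sup>s" by (force simp: symcl_def)
    with xy have "(u, y) \<in> ?R"
      by (auto simp: A_def intro: rtrancl_on_into_rtrancl_on)
    then show False using xy by (simp add: A_def)
  qed
qed (fact assms(1))

text \<open>
  With \<open>card A = 1\<close> the part \<open>B\<close> is bounded by the number of non-neighbours of one vertex, with
  \<open>card A \<ge> 2\<close> by the number of common non-neighbours of two.
\<close>

lemma card_separated_le: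
  fixes A B :: "'f::{field,finite} set"
  assumes odd: "odd CARD('f)" and "A \<noteq> {}" "B \<noteq> {}"
    and AB: "\<And>x y. x \<in> A \<Longrightarrow> y \<in> B \<Longrightarrow> x - y \<in> nonsquares \<and> y - x \<in> nonsquares"
  shows "card A + card B \<le> card (nonzero_squares :: 'f set) + 1"
proof -
  let ?k = "card (nonzero_squares :: 'f set)"
  have le: "card D \<le> ?k \<and> (card C \<noteq> 1 \<longrightarrow> 2 * card D \<le> ?k)"
    if "C \<noteq> {}" and CD: "\<And>x y. x \<in> C \<Longrightarrow> y \<in> D \<Longrightarrow> y - x \<in> nonsquares" for C D :: "'f set"
  proof
    obtain x where x: "x \<in> C" using \<open>C \<noteq> {}\<close> by blast
    have "card D \<le> card {z. z - x \<in> nonsquares}"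
      by (rule card_mono) (use CD x in auto)
    then show "card D \<le> ?k" using card_nonsquares[OF odd] by (simp add: card_diff_in)
    show "card C \<noteq> 1 \<longrightarrow> 2 * card D \<le> ?k"
    proof
      assume "card C \<noteq> 1"
      then obtain y where y: "y \<in> C" "x \<noteq> y"
        using x by (metis is_singletonI' is_singleton_altdef empty_iff)
      have "card D \<le> card {z. z - x \<in> nonsquares \<and> z - y \<in> nonsquares}"
        by (rule card_mono) (use CD x y in auto)
      then show "2 * card D \<le> ?k" using card_common_nonneighbours_le[OF odd y(2)] by linarith
    qed
  qed
  have "card B \<le> ?k \<and> (card A \<noteq> 1 \<longrightarrow> 2 * card B \<le> ?k)"
    by (rule le) (use assms in auto)
  moreover have "card A \<le> ?k \<and> (card B \<noteq> 1 \<longrightarrow> 2 * card A \<le> ?k)"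
    by (rule le) (use assms in auto)
  ultimately show ?thesis by linarith
qed

lemma k_connected_paley:
  assumes odd: "odd CARD('f::{field,finite})" and "2 \<le> CARD('f)"
  shows "k_connected (card (nonzero_squares :: 'f set)) (paley_graph :: 'f pair_pre_digraph)"
  unfolding k_connected_def
proof (intro conjI allI impI)
  let ?k = "card (nonzero_squares :: 'f set)" and ?X = "paley_graph :: 'f pair_pre_digraph"
  have q: "2 * ?k + 1 = CARD('f)" by (rule card_nonzero_squares[OF odd])
  show "?k + 1 \<le> card (pverts ?X)" using q by (simp add: paley_graph_def)
  fix S assume "S \<subseteq> pverts ?X" and S: "card S < ?k"
  have V: "pverts ?X - S = - S" by (auto simp: paley_graph_def)
  have "card (- S) + card S = CARD('f)"
    using card_Un_disjoint[of "- S" S] by (simp add: Un_commute)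
  then have cardV: "?k + 2 \<le> card (- S)" using S q by linarith
  show "Digraph_Component.connected (with_proj ?X \<restriction> (pverts ?X - S))"
    unfolding V
  proof (rule connected_if_no_empty_cut)
    show "verts (with_proj ?X \<restriction> - S) \<noteq> {}" using cardV by force
    fix A B assume cut: "A \<union> B = verts (with_proj ?X \<restriction> - S)" "A \<inter> B = {}" "A \<noteq> {}" "B \<noteq> {}"
    then have "card A + card B = card (- S)"
      by (metis card_Un_disjoint finite induce_subgraph_verts)
    then have "\<not> card A + card B \<le> ?k + 1" using cardV by linarith
    then obtain x y where xy: "x \<in> A" "y \<in> B" "x - y \<notin> nonsquares \<or> y - x \<notin> nonsquares"
      using card_separated_le[OF odd cut(3,4)] by blast
    moreover have "x \<noteq> y" "x \<in> - S" "y \<in> - S" using xy cut by auto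
    ultimately have "(x, y) \<in> arcs_ends (with_proj ?X \<restriction> - S) \<or>
        (y, x) \<in> arcs_ends (with_proj ?X \<restriction> - S)"
      by (auto simp: arcs_ends_conv image_iff paley_graph_def nonsquares_def)
    then show "\<exists>x\<in>A. \<exists>y\<in>B. (x, y) \<in> arcs_ends (with_proj ?X \<restriction> - S) \<or>
        (y, x) \<in> arcs_ends (with_proj ?X \<restriction> - S)"
      using xy by blast
  qed
qed

lemma k_connected_le_vertex_connectivity:
  assumes "k_connected k X"
  shows "k \<le> vertex_connectivity X"
  unfolding vertex_connectivity_def
proof (rule Max_ge)
  show "finite {k. k_connected k X}"
    by (rule finite_subset[of _ "{..card (pverts X)}"]) (auto simp: k_connected_def)
qed (use assms in simp)

section \<open>Paley graphs whose order lies in the given range\<close>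

theorem proposition4p3:
  fixes r n a b :: int
    and X :: "'f::{field,finite} pair_pre_digraph"
  assumes "r > 6"
    and "3 * r + 3 \<le> n" and "n \<le> r\<^sup>2"
    and "a = n - 2 * r + 1" and "b = 2 * r - 1"
    and "primepow a" and "[a = 1] (mod 4)"
    and "2 * r + 5 \<le> a" and "a \<le> min (4 * r - 3) ((r - 1)\<^sup>2)"
    and "int CARD('f) = a" and "X = paley_graph"
  shows "int (independence_number X) \<le> r - 1
    \<and> int (vertex_connectivity X) \<ge> a - b
    \<and> int (max_degree X) \<ge> r + 2"
proof -
  let ?k = "card (nonzero_squares :: 'f set)"
  have "a mod 4 = 1" using assms(7) by (simp add: cong_def)
  then have "odd a" by presburger
  then have odd: "odd CARD('f)" using assms(10) by auto
  have ge2: "2 \<le> CARD('f)" using assms(1,8,10) by linarith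
  have "2 * ?k + 1 = CARD('f)" by (rule card_nonzero_squares[OF odd])
  then have k: "2 * int ?k + 1 = a" using assms(10) by linarith
  have "int ((independence_number X)\<^sup>2) \<le> int CARD('f)"
    using independence_number_paley[OF odd ge2] assms(11) by (simp only: of_nat_le_iff)
  also have "\<dots> \<le> (r - 1)\<^sup>2" using assms(9,10) by simp
  finally have "(int (independence_number X))\<^sup>2 \<le> (r - 1)\<^sup>2" by simp
  then have "int (independence_number X) \<le> r - 1"
    by (rule power2_le_imp_le) (use assms(1) in linarith)
  moreover have "?k \<le> vertex_connectivity X"
    using k_connected_le_vertex_connectivity[OF k_connected_paley[OF odd ge2]] assms(11) by simp
  moreover have "max_degree X = ?k" using assms(11) by (simp add: max_degree_paley)
  ultimately show ?thesis using k assms(5,8,9) by linarith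
qed

end
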